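(* Let $X$ be a countably compact $\sigma$-space, let $Y$ be a second-countable topological space, and let $f: X\to Y$ be $\sigma$-continuous. Then $f(X)$ is compact in $Y$.
   Context: A $\sigma$-topology on a nonempty set $X$ is a family $\tau\subseteq\mathcal{P}(X)$ containing $\emptyset$ and $X$ and closed under finite intersections and countable unions; its members are called $\sigma$-open, and $(X,\tau)$ is called a $\sigma$-space. Every topological space is a $\sigma$-space, with the open sets as $\sigma$-open sets. A function between $\sigma$-spaces is $\sigma$-continuous if the preimage of every $\sigma$-open set is $\sigma$-open. A $\sigma$-space is countably compact if every countable cover of it by $\sigma$-open sets has a finite subcover. Compact means that every open cover has a finite subcover. *)

theory Defs
  imports "HOL-Analysis.Analysis"
begin

text \<open>
  A \<open>\<sigma>\<close>-space is given by its carrier \<open>X\<close> and the family \<open>\<sigma>\<close> of its \<open>\<sigma>\<close>-open sets. The empty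
  intersection is excluded because \<open>\<Inter>{} = UNIV\<close>; relative to \<open>X\<close> it is \<open>X\<close>, a member anyway.
\<close>

definition sigma_space :: "'a set \<Rightarrow> 'a set set \<Rightarrow> bool" where
  "sigma_space X \<sigma> \<longleftrightarrow>
     X \<noteq> {} \<and> \<sigma> \<subseteq> Pow X \<and> {} \<in> \<sigma> \<and> X \<in> \<sigma> \<and>
     (\<forall>\<F>. \<F> \<subseteq> \<sigma> \<and> finite \<F> \<and> \<F> \<noteq> {} \<longrightarrow> \<Inter>\<F> \<in> \<sigma>) \<and>
     (\<forall>\<U>. \<U> \<subseteq> \<sigma> \<and> countable \<U> \<longrightarrow> \<Union>\<U> \<in> \<sigma>)"

definition sigma_continuous ::
  "'a set \<Rightarrow> 'a set set \<Rightarrow> 'b set \<Rightarrow> 'b set set \<Rightarrow> ('a \<Rightarrow> 'b) \<Rightarrow> bool" where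
  "sigma_continuous X \<sigma> Y \<tau> f \<longleftrightarrow>
     f \<in> X \<rightarrow> Y \<and> (\<forall>V \<in> \<tau>. {x \<in> X. f x \<in> V} \<in> \<sigma>)"

definition sigma_countably_compact :: "'a set \<Rightarrow> 'a set set \<Rightarrow> bool" where
  "sigma_countably_compact X \<sigma> \<longleftrightarrow>
     (\<forall>\<U>. countable \<U> \<and> \<U> \<subseteq> \<sigma> \<and> X \<subseteq> \<Union>\<U>
        \<longrightarrow> (\<exists>\<F>. finite \<F> \<and> \<F> \<subseteq> \<U> \<and> X \<subseteq> \<Union>\<F>))"

lemma sigma_space_topology:
  assumes "topspace Y \<noteq> {}"
  shows "sigma_space (topspace Y) {V. openin Y V}"
  using assms unfolding sigma_space_def
  by (auto intro: openin_Inter openin_Union dest: openin_subset)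

end

theory Submission
  imports Defs
begin

text \<open>
  A subset of a second-countable space is Lindelof in its subspace topology, so any open cover of
  the image \<open>f ` X\<close> may first be thinned to a countable one, whose preimages form a
  countable cover of \<open>X\<close> by members of \<open>\<sigma>\<close>. Countable compactness selects finitely many of these,
  and the corresponding open sets cover the image.
\<close>

theorem theorem2p9:
  fixes X :: "'a set" and \<sigma> :: "'a set set"
    and Y :: "'b topology" and f :: "'a \<Rightarrow> 'b"
  assumes "sigma_space X \<sigma>"
    and "sigma_countably_compact X \<sigma>"
    and "second_countable Y"
    and "sigma_continuous X \<sigma> (topspace Y) {V. openin Y V} f"
  shows "compactin Y (f ` X)"
proof -
  have image_sub: "f ` X \<subseteq> topspace Y"
    and preimage: "\<And>V. openin Y V \<Longrightarrow> {x \<in> X. f x \<in> V} \<in> \<sigma>"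
    using assms(4) by (auto simp: sigma_continuous_def)
  have fin_subcover: "\<exists>\<F>. finite \<F> \<and> \<F> \<subseteq> \<U> \<and> f ` X \<subseteq> \<Union>\<F>"
    if open_cover: "\<forall>U\<in>\<U>. openin Y U" and cover: "f ` X \<subseteq> \<Union>\<U>" for \<U>
  proof -
    have "Lindelof_space (subtopology Y (f ` X))"
      using assms(3) by (intro second_countable_imp_Lindelof_space second_countable_subtopology)
    then have "\<exists>\<V>. countable \<V> \<and> \<V> \<subseteq> \<U> \<and> f ` X \<subseteq> \<Union>\<V>"
      using open_cover cover by (simp add: Lindelof_space_subtopology_subset[OF image_sub])
    then obtain \<V> where \<V>: "countable \<V>" "\<V> \<subseteq> \<U>" "f ` X \<subseteq> \<Union>\<V>"
      by (elim exE conjE)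
    let ?pre = "\<lambda>V. {x \<in> X. f x \<in> V}"
    have "countable (?pre ` \<V>)" "?pre ` \<V> \<subseteq> \<sigma>" "X \<subseteq> \<Union>(?pre ` \<V>)"
      using \<V> open_cover preimage by auto
    then have "\<exists>\<G>. finite \<G> \<and> \<G> \<subseteq> ?pre ` \<V> \<and> X \<subseteq> \<Union>\<G>"
      using assms(2) by (simp only: sigma_countably_compact_def)
    then obtain \<G> where \<G>: "finite \<G>" "\<G> \<subseteq> ?pre ` \<V>" "X \<subseteq> \<Union>\<G>"
      by (elim exE conjE)
    obtain \<F> where \<F>: "\<F> \<subseteq> \<V>" "finite \<F>" "\<G> = ?pre ` \<F>"
      using finite_subset_image[OF \<G>(1,2)] by (elim exE conjE)
    have "f ` X \<subseteq> \<Union>\<F>"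
      using \<G>(3) unfolding \<F>(3) by auto
    with \<F>(2) order_trans[OF \<F>(1) \<V>(2)] show ?thesis
      by (intro exI[of _ \<F>]) simp
  qed
  show ?thesis
    unfolding compactin_def using image_sub fin_subcover by simp
qed

end
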